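(* Let $A$ be a skew brace and let $I\subset A$ be an ideal of $A$. Let $[I,A]_{\mathsf{Ab}}$ be the subgroup of $(A,+)$ generated by the set $$\{\,[i,b]_+,\ i*b,\ [i,b]_\circ \mid i\in I,\ b\in A\,\}.$$ Then $[I,A]_{\mathsf{Ab}}$ is an ideal of $A$.
   Context: A skew brace is a triple $(A,+,\circ)$ where $(A,+)$ and $(A,\circ)$ are (not necessarily abelian) groups such that $a\circ(b+c)=a\circ b-a+a\circ c$ for all $a,b,c\in A$. The inverse of $a$ in $(A,\circ)$ is denoted $a'$. For $a,b\in A$ put $a*b=-a+a\circ b-b$, $[a,b]_+=a+b-a-b$ and $[a,b]_\circ=a\circ b\circ a'\circ b'$. An ideal of $A$ is a normal subgroup $I$ of $(A,+)$ such that $a*x\in I$ and $x*a\in I$ for all $a\in A$, $x\in I$. *)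

theory Defs
  imports "HOL-Algebra.Generated_Groups" "HOL-Algebra.Ring"
begin

text \<open>
  A skew brace is carried by the ring record, without assuming any ring axioms:
  the fields \<open>add\<close> and \<open>zero\<close> hold the additive group, the fields \<open>mult\<close> and \<open>one\<close> the circle
  group. Neither group is assumed to be commutative, so \<open>x \<ominus> y\<close> stands for \<open>x \<oplus> (\<ominus> y)\<close>, and
  the order of summands matters. \<open>inv x\<close> is the inverse of \<open>x\<close> in the circle group.
\<close>

locale skew_brace =
  fixes A :: "('a, 'm) ring_scheme" (structure)
  assumes add_group: "group (add_monoid A)"
    and circ_group: "group A"
    and circ_add: "\<lbrakk>a \<in> carrier A; b \<in> carrier A; c \<in> carrier A\<rbrakk>
      \<Longrightarrow> a \<otimes> (b \<oplus> c) = a \<otimes> b \<ominus> a \<oplus> a \<otimes> c"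

definition brace_star :: "('a, 'm) ring_scheme \<Rightarrow> 'a \<Rightarrow> 'a \<Rightarrow> 'a" where
  "brace_star A a b = \<ominus>\<^bsub>A\<^esub> a \<oplus>\<^bsub>A\<^esub> a \<otimes>\<^bsub>A\<^esub> b \<ominus>\<^bsub>A\<^esub> b"

definition add_commutator :: "('a, 'm) ring_scheme \<Rightarrow> 'a \<Rightarrow> 'a \<Rightarrow> 'a" where
  "add_commutator A a b = a \<oplus>\<^bsub>A\<^esub> b \<ominus>\<^bsub>A\<^esub> a \<ominus>\<^bsub>A\<^esub> b"

definition circ_commutator :: "('a, 'm) ring_scheme \<Rightarrow> 'a \<Rightarrow> 'a \<Rightarrow> 'a" where
  "circ_commutator A a b = a \<otimes>\<^bsub>A\<^esub> b \<otimes>\<^bsub>A\<^esub> inv\<^bsub>A\<^esub> a \<otimes>\<^bsub>A\<^esub> inv\<^bsub>A\<^esub> b"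

definition brace_ideal :: "'a set \<Rightarrow> ('a, 'm) ring_scheme \<Rightarrow> bool" where
  "brace_ideal I A \<longleftrightarrow> I \<lhd> add_monoid A \<and>
     (\<forall>a\<in>carrier A. \<forall>x\<in>I. brace_star A a x \<in> I \<and> brace_star A x a \<in> I)"

definition Ab_commutator :: "('a, 'm) ring_scheme \<Rightarrow> 'a set \<Rightarrow> 'a set" where
  "Ab_commutator A I = generate (add_monoid A)
     (\<Union>i\<in>I. \<Union>b\<in>carrier A. {add_commutator A i b, brace_star A i b, circ_commutator A i b})"

end

theory Submission
  imports Defs
begin

text \<open>
  Write \<open>J\<close> for the subgroup generated by the three kinds of commutators. An ideal \<open>I\<close> is also
  normal in the circle group, so \<open>J \<subseteq> I\<close>. Hence \<open>[j,b]\<close> and \<open>j * b\<close> are generators of \<open>J\<close> for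
  all \<open>j \<in> J\<close>, which gives normality of \<open>J\<close> and \<open>J * A \<subseteq> J\<close>. For \<open>i \<in> I\<close> and \<open>b \<in> A\<close>, one has
  modulo \<open>J\<close> that \<open>b + b * i + i = b \<circ> i \<equiv> i \<circ> b = i + i * b + b \<equiv> b + i\<close>, so \<open>b * i \<in> J\<close>;
  thus even \<open>A * I \<subseteq> J\<close>.
\<close>

sublocale skew_brace \<subseteq> group A
  by (rule circ_group)

sublocale skew_brace \<subseteq> add: group "add_monoid A"
  rewrites "carrier (add_monoid A) = carrier A"
    and "mult (add_monoid A) = add A"
    and "one (add_monoid A) = zero A"
    and "m_inv (add_monoid A) = a_inv A"
  by (rule add_group) (auto simp: a_inv_def)

context skew_brace
begin

text \<open>Cancellation for words bracketed to the right, the normal form that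
  \<open>add_word_simps\<close> aims at in the noncommutative additive group.\<close>

lemma add_inv_cancel:
  assumes "a \<in> carrier A" "b \<in> carrier A"
  shows "\<ominus> a \<oplus> (a \<oplus> b) = b" and "a \<oplus> (\<ominus> a \<oplus> b) = b"
  using assms by (simp_all flip: add.m_assoc)

lemmas add_word_simps = a_minus_def add.m_assoc add.inv_mult_group add_inv_cancel

lemma star_closed [simp]:
  "\<lbrakk>a \<in> carrier A; b \<in> carrier A\<rbrakk> \<Longrightarrow> brace_star A a b \<in> carrier A"
  by (simp add: brace_star_def a_minus_def)

lemma circ_eq_star:
  "\<lbrakk>a \<in> carrier A; b \<in> carrier A\<rbrakk> \<Longrightarrow> a \<otimes> b = a \<oplus> (brace_star A a b \<oplus> b)"
  by (simp add: brace_star_def add_word_simps)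

lemma one_eq_zero: "\<one> = \<zero>"
proof -
  \<comment> \<open>For a = 1 and b = c = 0 the brace law reads 0 = 0 - 1 + 0.\<close>
  have "\<zero> = \<ominus> \<one>"
    using circ_add[of \<one> \<zero> \<zero>] by (simp add: a_minus_def)
  then show ?thesis
    by (metis add.inv_inv add.inv_one one_closed)
qed

lemma ideal_subset: "brace_ideal I A \<Longrightarrow> i \<in> I \<Longrightarrow> i \<in> carrier A"
  unfolding brace_ideal_def using normal_imp_subgroup subgroup.subset by fastforce

lemma ideal_add:
  "\<lbrakk>brace_ideal I A; i \<in> I; j \<in> I\<rbrakk> \<Longrightarrow> i \<oplus> j \<in> I"
  unfolding brace_ideal_def using normal_imp_subgroup subgroup.m_closed by fastforce

lemma ideal_neg:
  "\<lbrakk>brace_ideal I A; i \<in> I\<rbrakk> \<Longrightarrow> \<ominus> i \<in> I"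
  unfolding brace_ideal_def a_inv_def using normal_imp_subgroup subgroup.m_inv_closed by fastforce

lemma ideal_conj:
  assumes "brace_ideal I A" "i \<in> I" "a \<in> carrier A"
  shows "a \<oplus> (i \<oplus> \<ominus> a) \<in> I"
proof -
  have "a \<oplus> i \<oplus> \<ominus> a \<in> I"
    using assms normal.inv_op_closed2[of I "add_monoid A" a i]
    by (simp add: brace_ideal_def a_inv_def)
  then show ?thesis
    using assms ideal_subset by (simp add: add.m_assoc)
qed

lemma ideal_star:
  assumes "brace_ideal I A" "i \<in> I" "a \<in> carrier A"
  shows "brace_star A a i \<in> I" and "brace_star A i a \<in> I"
  using assms by (auto simp: brace_ideal_def)

lemma ideal_circ:
  assumes "brace_ideal I A" "i \<in> I" "j \<in> I"
  shows "i \<otimes> j \<in> I"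
  using assms by (simp add: circ_eq_star ideal_subset ideal_add ideal_star)

text \<open>Expanding i' o i = 0 additively gives i' + i' * i + i = 0, and i' * i lies in
  \<open>I\<close> because its right factor does.\<close>

lemma ideal_circ_inv:
  assumes I: "brace_ideal I A" "i \<in> I"
  shows "inv i \<in> I"
proof -
  have i: "i \<in> carrier A" "inv i \<in> carrier A"
    using I ideal_subset by auto
  have "inv i \<oplus> (brace_star A (inv i) i \<oplus> i) = \<zero>"
    using i by (simp flip: circ_eq_star one_eq_zero)
  then have "inv i = \<ominus> (brace_star A (inv i) i \<oplus> i)"
    using i add.inv_equality[of "inv i" "brace_star A (inv i) i \<oplus> i"] by simp
  then show ?thesis
    using I i by (metis ideal_add ideal_neg ideal_star(1))
qed

text \<open>The brace law turns a circle conjugate into an additive one: with i o a' = w + a', it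
  gives a o (w + a') = a o w - a, since a o a' = 0. This is the additive conjugate by a of a * w +
  w.\<close>

lemma ideal_circ_conj:
  assumes I: "brace_ideal I A" "i \<in> I" and a: "a \<in> carrier A"
  shows "a \<otimes> i \<otimes> inv a \<in> I"
proof -
  let ?b = "inv a"
  define w where "w = i \<oplus> brace_star A i ?b"
  have i: "i \<in> carrier A" using I ideal_subset by auto
  have w: "w \<in> I" "w \<in> carrier A"
    using I a ideal_add ideal_star ideal_subset unfolding w_def by auto
  have "a \<otimes> i \<otimes> ?b = a \<otimes> (w \<oplus> ?b)"
    using a i by (simp add: m_assoc circ_eq_star[of i ?b] w_def add.m_assoc)
  also have "\<dots> = a \<otimes> w \<ominus> a"
    using a w circ_add[of a w ?b] by (simp add: one_eq_zero a_minus_def)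
  also have "\<dots> = a \<oplus> ((brace_star A a w \<oplus> w) \<oplus> \<ominus> a)"
    using a w by (simp add: circ_eq_star add_word_simps)
  also have "\<dots> \<in> I"
    using I a w by (simp add: ideal_conj ideal_add ideal_star)
  finally show ?thesis .
qed

lemma Ab_commutator_generator:
  assumes "i \<in> I" "b \<in> carrier A"
  shows "add_commutator A i b \<in> Ab_commutator A I"
    and "brace_star A i b \<in> Ab_commutator A I"
    and "circ_commutator A i b \<in> Ab_commutator A I"
  using assms unfolding Ab_commutator_def by (auto intro!: generate.incl)

text \<open>Each commutator, additive or circle, is i followed by a conjugate of the inverse of
  i.\<close>

lemma Ab_commutator_subset:
  assumes I: "brace_ideal I A"
  shows "Ab_commutator A I \<subseteq> I"
  unfolding Ab_commutator_def
proof (rule add.generate_subgroup_incl)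
  show "subgroup I (add_monoid A)"
    using I normal_imp_subgroup by (auto simp: brace_ideal_def)
  have "add_commutator A i b \<in> I" if "i \<in> I" "b \<in> carrier A" for i b
  proof -
    have "add_commutator A i b = i \<oplus> (b \<oplus> (\<ominus> i \<oplus> \<ominus> b))"
      using that I ideal_subset by (simp add: add_commutator_def add_word_simps)
    then show ?thesis
      using that I by (simp add: ideal_add ideal_neg ideal_conj)
  qed
  moreover have "circ_commutator A i b \<in> I" if "i \<in> I" "b \<in> carrier A" for i b
  proof -
    have "circ_commutator A i b = i \<otimes> (b \<otimes> inv i \<otimes> inv b)"
      using that I ideal_subset by (simp add: circ_commutator_def m_assoc)
    then show ?thesis
      using that I by (simp add: ideal_circ ideal_circ_inv ideal_circ_conj)
  qed
  ultimately show "(\<Union>i\<in>I. \<Union>b\<in>carrier A.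
      {add_commutator A i b, brace_star A i b, circ_commutator A i b}) \<subseteq> I"
    using I ideal_star by auto
qed

lemma Ab_commutator_subgroup:
  assumes I: "brace_ideal I A"
  shows "subgroup (Ab_commutator A I) (add_monoid A)"
  unfolding Ab_commutator_def
  using I ideal_subset
  by (intro add.generate_is_subgroup)
     (auto simp: add_commutator_def circ_commutator_def a_minus_def)

lemma Ab_commutator_normal:
  assumes I: "brace_ideal I A"
  shows "Ab_commutator A I \<lhd> add_monoid A"
  unfolding add.normal_inv_iff
proof (intro conjI ballI Ab_commutator_subgroup[OF I])
  let ?J = "Ab_commutator A I"
  interpret J: subgroup ?J "add_monoid A"
    by (rule Ab_commutator_subgroup[OF I])
  fix b j assume b: "b \<in> carrier A" and j: "j \<in> ?J"
  then have jI: "j \<in> I" "j \<in> carrier A"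
    using Ab_commutator_subset[OF I] I ideal_subset by auto
  \<comment> \<open>Since \<open>j\<close> is in \<open>I\<close>, [j,b] is a generator, and -[j,b]
    + j collapses to b + j - b.\<close>
  have "\<ominus> (add_commutator A j b) \<oplus> j \<in> ?J"
    using J.m_closed[OF J.m_inv_closed[OF Ab_commutator_generator(1)[OF jI(1) b]] j]
    by (simp add: a_inv_def)
  then show "b \<oplus> j \<oplus> \<ominus> b \<in> ?J"
    using b jI by (simp add: add_commutator_def add_word_simps)
qed

lemma star_in_Ab_commutator:
  assumes I: "brace_ideal I A" "i \<in> I" and b: "b \<in> carrier A"
  shows "brace_star A b i \<in> Ab_commutator A I"
proof -
  let ?J = "Ab_commutator A I"
  interpret J: normal ?J "add_monoid A"
    by (rule Ab_commutator_normal[OF I(1)])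
  have add: "x \<oplus> y \<in> ?J" if "x \<in> ?J" "y \<in> ?J" for x y
    using J.m_closed that by simp
  have neg: "\<ominus> x \<in> ?J" if "x \<in> ?J" for x
    using J.m_inv_closed that by (simp add: a_inv_def)
  have conj: "\<ominus> a \<oplus> x \<oplus> a \<in> ?J" "a \<oplus> x \<oplus> \<ominus> a \<in> ?J" if "x \<in> ?J" "a \<in> carrier A" for a x
    using J.inv_op_closed1 J.inv_op_closed2 that by (simp_all add: a_inv_def)
  have i: "i \<in> carrier A" using I ideal_subset by auto
  define c where "c = circ_commutator A i b"
  \<comment> \<open>\<open>s\<close> is the correction between c o (b o i) and c + b o i. It lies in
    \<open>?J\<close> because \<open>c\<close> is in \<open>I\<close>, so that \<open>s\<close> is
    itself a generator.\<close>
  define s where "s = brace_star A c (b \<otimes> i)"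
  define t where "t = brace_star A i b"
  define u where "u = add_commutator A i b"
  define v where "v = brace_star A b i"
  have J: "c \<in> ?J" "t \<in> ?J" "u \<in> ?J"
    using Ab_commutator_generator I b by (auto simp: c_def t_def u_def)
  have "c \<in> I" using J Ab_commutator_subset I by auto
  then have s: "s \<in> ?J"
    using Ab_commutator_generator(2) i b by (simp add: s_def)
  have carr: "c \<in> carrier A" "s \<in> carrier A" "t \<in> carrier A" "u \<in> carrier A" "v \<in> carrier A"
    using J s J.subset i b by (auto simp: v_def)
  have "inv i \<otimes> (inv b \<otimes> (b \<otimes> i)) = \<one>"
    using i b by (simp flip: m_assoc[of "inv b"])
  then have "c \<otimes> (b \<otimes> i) = i \<otimes> b"
    using i b by (simp add: c_def circ_commutator_def m_assoc)
  then have "c \<oplus> (s \<oplus> (b \<oplus> (v \<oplus> i))) = i \<oplus> (t \<oplus> b)"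
    using circ_eq_star[of c "b \<otimes> i"] circ_eq_star[of b i] circ_eq_star[of i b] carr i b
    by (simp add: s_def t_def v_def)
  \<comment> \<open>Move \<open>t\<close> to the left of \<open>i\<close> by conjugation, then use i
    + b = u + b + i.\<close>
  also have "\<dots> = (i \<oplus> t \<oplus> \<ominus> i) \<oplus> u \<oplus> b \<oplus> i"
    using carr i b by (simp add: u_def add_commutator_def add_word_simps)
  finally have eq: "c \<oplus> (s \<oplus> (b \<oplus> (v \<oplus> i))) = (i \<oplus> t \<oplus> \<ominus> i) \<oplus> u \<oplus> b \<oplus> i" .
  \<comment> \<open>Solve for \<open>v\<close>: the final \<open>i\<close> cancels on both sides,
    leaving a conjugate by \<open>b\<close> of an element of \<open>?J\<close>.\<close>
  have "v = \<ominus> b \<oplus> (\<ominus> s \<oplus> (\<ominus> c \<oplus> (c \<oplus> (s \<oplus> (b \<oplus> (v \<oplus> i)))))) \<oplus> \<ominus> i"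
    using carr i b by (simp add: add_word_simps)
  also have "\<dots> = \<ominus> b \<oplus> (\<ominus> s \<oplus> (\<ominus> c \<oplus> ((i \<oplus> t \<oplus> \<ominus> i) \<oplus> u))) \<oplus> b"
    unfolding eq using carr i b by (simp add: add_word_simps)
  also have "\<dots> \<in> ?J"
    using J s i b by (intro conj add neg) auto
  finally show ?thesis by (simp add: v_def)
qed

end

theorem proposition5p3:
  fixes A :: "('a, 'm) ring_scheme" and I :: "'a set"
  assumes "skew_brace A" and "brace_ideal I A"
  shows "brace_ideal (Ab_commutator A I) A"
proof -
  interpret skew_brace A by fact
  show ?thesis
    unfolding brace_ideal_def
    \<comment> \<open>Both star conditions follow by viewing an element of the commutator as an
      element of \<open>I\<close>.\<close>
    using Ab_commutator_normal Ab_commutator_subset star_in_Ab_commutator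
      Ab_commutator_generator(2) assms(2) by blast
qed

end
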